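(* For every positive integer $k$, there exist a $k$-regular graph $G$ and a tournament $T$ on the same vertex set such that $G[N_T^+(v)]$ is a forest for every vertex $v$.
   Context: Graphs are finite and simple; a tournament is an orientation of a finite complete graph. $G[S]$ denotes the subgraph of $G$ induced on a vertex set $S$. For a tournament $T$, $N_T^+(v)$ is the set of vertices $w$ such that $T$ has an arc from $v$ to $w$ (so $v \notin N_T^+(v)$). A forest is an acyclic graph. *)

theory Defs
  imports "Graph_Theory.Graph_Theory"
begin

text \<open>
  A finite simple graph is a symmetric digraph satisfying \<^locale>\<open>graph\<close>: every edge
  is represented by its two opposite arcs, so the degree of a vertex is its out-degree.
\<close>

definition regular_graph :: "nat \<Rightarrow> ('a,'b) pre_digraph \<Rightarrow> bool" where
  "regular_graph k G \<longleftrightarrow> graph G \<and> (\<forall>v\<in>verts G. out_degree G v = k)"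

text \<open>
  The library predicate \<^const>\<open>forest\<close> is not usable for undirected graphs, since an
  edge traversed back and forth is a directed cycle of length 2. A cycle of a simple graph
  has at least three edges.
\<close>

definition undirected_forest :: "('a,'b) pre_digraph \<Rightarrow> bool" where
  "undirected_forest G \<longleftrightarrow> graph G \<and> \<not> (\<exists>p. pre_digraph.cycle G p \<and> 3 \<le> length p)"

definition tournament :: "('a,'b) pre_digraph \<Rightarrow> bool" where
  "tournament T \<longleftrightarrow> digraph T \<and>
     (\<forall>u\<in>verts T. \<forall>v\<in>verts T. u \<noteq> v \<longrightarrow> (u \<rightarrow>\<^bsub>T\<^esub> v) \<noteq> (v \<rightarrow>\<^bsub>T\<^esub> u))"

definition out_neighbourhood :: "('a,'b) pre_digraph \<Rightarrow> 'a \<Rightarrow> 'a set" where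
  "out_neighbourhood T v = {w. v \<rightarrow>\<^bsub>T\<^esub> w}"

end

theory Submission
  imports Defs
begin

text \<open>
  The graph is the cube \<open>Q\<^sub>k\<close> on the numbers below \<open>2 ^ k\<close>: two numbers are adjacent
  if they differ in exactly one binary digit. Colour a number by the parity of its digit
  sum, so that every edge joins vertices of different colours. In the tournament, vertices
  of equal colour are directed upwards and vertices of different colours downwards. Hence \<open>v\<close>
  dominates the vertices of its own colour above it and those of the other colour below it.
  The point of this choice is that each edge inside \<open>N\<^sup>+(v)\<close> straddles \<open>v\<close>: one end is
  below \<open>v\<close>, the other above (\<open>common_out_neighbours_straddle\<close>).

  For every \<open>v\<close>, the edges of the cube straddling \<open>v\<close> form a forest. The length
  \<open>\<bar>x - y\<bar>\<close> of an edge that flips digit \<open>i\<close> is \<open>2 ^ i\<close>, so edges of equal length are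
  disjoint and different lengths differ by a factor of at least two. Take a longest edge \<open>xy\<close>
  of a cycle. The neighbouring edges of the cycle at \<open>x\<close> and at \<open>y\<close> are at most half as
  long as \<open>xy\<close>. They straddle \<open>v\<close> as well, so both \<open>x\<close> and \<open>y\<close> are at distance less than
  half of \<open>\<bar>x - y\<bar>\<close> from \<open>v\<close>, which is absurd (\<open>straddling_edges_acyclic\<close>).
\<close>

section \<open>Consecutive arcs of a cycle\<close>

context pre_digraph
begin

lemma cas_awalk_verts: "cas u p v \<Longrightarrow> awalk_verts u p = u # map (head G) p"
  by (induction p arbitrary: u) auto

lemma cas_last: "cas u p v \<Longrightarrow> p \<noteq> [] \<Longrightarrow> head G (last p) = v"
  by (induction p arbitrary: u) (auto split: if_splits)

lemma cas_consecutive: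
  "cas u p v \<Longrightarrow> Suc j < length p \<Longrightarrow> tail G (p ! Suc j) = head G (p ! j)"
proof (induction p arbitrary: u j)
  case (Cons e p)
  then show ?case by (cases j; cases p) auto
qed simp

text \<open>
  In an undirected graph a closed walk may turn back along an edge. A cycle of length at
  least three never does, since its heads are distinct: this is the only consequence of
  being a cycle that the extremal argument below needs.
\<close>

lemma cycle_arc_neighbours:
  assumes "cycle p" "3 \<le> length p" "e \<in> set p"
  obtains e1 e2 where "e1 \<in> set p" "head G e1 = tail G e" "tail G e1 \<noteq> head G e"
    and "e2 \<in> set p" "tail G e2 = head G e" "head G e2 \<noteq> tail G e"
proof -
  let ?n = "length p"
  obtain u where u: "cas u p u" "distinct (tl (awalk_verts u p))"
    using assms(1) by (auto simp: cycle_def awalk_def)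
  then have "distinct (map (head G) p)" by (simp add: cas_awalk_verts)
  then have head_inj: "head G (p ! a) = head G (p ! b) \<longleftrightarrow> a = b" if "a < ?n" "b < ?n" for a b
    using that by (metis length_map nth_eq_iff_index_eq nth_map)
  have "p \<noteq> []" using assms(2) by auto
  then have "tail G (p ! 0) = u" "head G (p ! (?n - 1)) = u"
    using u(1) cas_last[OF u(1)] by (auto simp: cas_simp hd_conv_nth last_conv_nth)
  define pred_idx where "pred_idx j = (if j = 0 then ?n - 1 else j - 1)" for j
  have pred_less: "pred_idx j < ?n" if "j < ?n" for j
    using that by (auto simp: pred_idx_def)
  have tail_eq: "tail G (p ! j) = head G (p ! pred_idx j)" if "j < ?n" for j
    using that cas_consecutive[OF u(1), of "j - 1"]
      \<open>tail G (p ! 0) = u\<close> \<open>head G (p ! (?n - 1)) = u\<close>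
    by (auto simp: pred_idx_def)
  obtain j where j: "j < ?n" "e = p ! j" using assms(3) by (metis in_set_conv_nth)
  define s where "s = (if j = ?n - 1 then 0 else Suc j)"
  have s: "s < ?n" "pred_idx s = j" "s \<noteq> pred_idx j" "pred_idx (pred_idx j) \<noteq> j"
    using j(1) assms(2) by (auto simp: s_def pred_idx_def)
  show thesis
  proof (rule that)
    show "p ! pred_idx j \<in> set p" "p ! s \<in> set p"
      using pred_less j(1) s(1) by auto
    show "head G (p ! pred_idx j) = tail G e" "tail G (p ! s) = head G e"
      using tail_eq j s(1,2) by auto
    show "tail G (p ! pred_idx j) \<noteq> head G e" "head G (p ! s) \<noteq> tail G e"
      using tail_eq head_inj pred_less j s by auto
  qed
qed

end

section \<open>The cube and its edge lengths\<close>

definition cube :: "nat \<Rightarrow> nat pair_pre_digraph" where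
  "cube k = \<lparr>pverts = {..<2 ^ k}, parcs = {(x, flip_bit i x) |x i. x < 2 ^ k \<and> i < k}\<rparr>"

lemma flip_bit_less_exp: "x < 2 ^ k \<Longrightarrow> i < k \<Longrightarrow> flip_bit i x < (2 ^ k :: nat)"
  by (metis take_bit_flip_bit_eq take_bit_nat_eq_self_iff linorder_not_le)

lemma flip_bit_flip_bit: "flip_bit i (flip_bit i x) = (x :: nat)"
  by (rule bit_eqI) (auto simp: bit_simps)

lemma flip_bit_length: "\<bar>int x - int (flip_bit i x)\<bar> = 2 ^ i"
proof -
  have "int (flip_bit i x) = int x + 2 ^ i \<or> int (flip_bit i x) = int x - 2 ^ i"
    unfolding of_nat_flip_bit_eq
    by (auto simp: flip_bit_eq_if set_bit_eq unset_bit_eq)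
  then show ?thesis by auto
qed

lemma flip_bit_inject: "flip_bit i x = flip_bit j x \<longleftrightarrow> i = j" for x :: nat
  by (metis flip_bit_length power_inject_exp one_less_numeral_iff semiring_norm(76))

lemma flip_bit_neq: "flip_bit i x \<noteq> (x :: nat)"
  using flip_bit_length[of x i] by auto

lemma graph_cube: "graph (cube k)"
proof -
  have "finite (parcs (cube k))"
    by (rule finite_subset[of _ "{..<2 ^ k} \<times> {..<2 ^ k}"])
       (auto simp: cube_def flip_bit_less_exp)
  moreover have "sym (parcs (cube k))"
    by (auto simp: cube_def sym_def) (metis flip_bit_flip_bit flip_bit_less_exp)
  ultimately have "pair_graph (cube k)"
    by unfold_locales
      (auto simp: cube_def flip_bit_less_exp symmetric_def flip_bit_neq flip_bit_neq[symmetric])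
  then show ?thesis by (rule pair_graph.pair_graphD_graph)
qed

lemma regular_cube: "regular_graph k (cube k)"
proof -
  have "out_degree (cube k) x = k" if "x < 2 ^ k" for x
  proof -
    have "out_arcs (cube k) x = (\<lambda>i. (x, flip_bit i x)) ` {..<k}"
      using that by (auto simp: out_arcs_def cube_def)
    moreover have "inj_on (\<lambda>i. (x, flip_bit i x)) {..<k}"
      by (auto simp: inj_on_def flip_bit_inject)
    ultimately show ?thesis by (simp add: out_degree_def card_image)
  qed
  then show ?thesis by (auto simp: regular_graph_def graph_cube) (auto simp: cube_def)
qed

text \<open>
  Edges of equal length at a vertex flip the same digit and so coincide; otherwise the
  lengths are different powers of two.
\<close>

lemma shorter_adjacent_arc:
  assumes "(x, y) \<in> parcs (cube k)" "(y, z) \<in> parcs (cube k)" "x \<noteq> z"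
    and "\<bar>int y - int z\<bar> \<le> \<bar>int x - int y\<bar>"
  shows "2 * \<bar>int y - int z\<bar> \<le> \<bar>int x - int y\<bar>"
proof -
  obtain i j where ij: "y = flip_bit i x" "z = flip_bit j y"
    using assms(1,2) by (auto simp: cube_def)
  have "i \<noteq> j" using ij assms(3) by (auto simp: flip_bit_flip_bit)
  moreover have "(2 :: int) ^ j \<le> 2 ^ i"
    using assms(4) unfolding ij by (simp add: flip_bit_length)
  ultimately have "Suc j \<le> i" by simp
  then have "(2 :: int) ^ Suc j \<le> 2 ^ i" by (intro power_increasing) auto
  then show ?thesis unfolding ij by (simp add: flip_bit_length)
qed

definition straddles :: "nat \<Rightarrow> nat \<times> nat \<Rightarrow> bool" where
  "straddles v e \<longleftrightarrow> fst e < v \<and> v < snd e \<or> snd e < v \<and> v < fst e"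

text \<open>
  A longest arc \<open>e\<close> of a cycle is too short: its two neighbours in the cycle keep both
  ends of \<open>e\<close> within less than half the length of \<open>e\<close> from \<open>v\<close>.
\<close>

lemma straddling_edges_acyclic:
  assumes S: "S \<subseteq> verts (cube k)"
    and straddles: "\<And>x y. (x, y) \<in> parcs (cube k) \<Longrightarrow> x \<in> S \<Longrightarrow> y \<in> S \<Longrightarrow> straddles v (x, y)"
  shows "undirected_forest (cube k \<restriction> S)"
  unfolding undirected_forest_def
proof (intro conjI notI)
  interpret graph "cube k" by (rule graph_cube)
  have ind: "induced_subgraph (cube k \<restriction> S) (cube k)" using S by (rule induced_induce)
  show "graph (cube k \<restriction> S)"
    by (intro digraph.graphI digraphI_induced induced_graph_imp_symmetric[OF sym_arcs] ind)
  assume "\<exists>p. pre_digraph.cycle (cube k \<restriction> S) p \<and> 3 \<le> length p"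
  then obtain p where p: "pre_digraph.cycle (cube k \<restriction> S) p" "3 \<le> length p" by blast
  have arc: "e \<in> parcs (cube k) \<and> straddles v e" if "e \<in> set p" for e
    using that p(1) straddles[of "fst e" "snd e"]
    by (auto simp: pre_digraph.cycle_def pre_digraph.awalk_def)
  define len :: "nat \<times> nat \<Rightarrow> int" where "len e = \<bar>int (fst e) - int (snd e)\<bar>" for e
  have "finite (len ` set p)" "len ` set p \<noteq> {}" using p(2) by auto
  then have "Max (len ` set p) \<in> len ` set p" by (rule Max_in)
  then obtain e where e: "e \<in> set p" "len e = Max (len ` set p)" by auto
  then have longest: "len f \<le> len e" if "f \<in> set p" for f using that by simp
  obtain e1 e2 where
    e1: "e1 \<in> set p" "snd e1 = fst e" "fst e1 \<noteq> snd e" and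
    e2: "e2 \<in> set p" "fst e2 = snd e" "snd e2 \<noteq> fst e"
    using pre_digraph.cycle_arc_neighbours[OF p e(1)]
    unfolding induce_subgraph_tail induce_subgraph_head with_proj_simps by metis
  obtain w x y z where eqs: "e1 = (w, x)" "e = (x, y)" "e2 = (y, z)" "w \<noteq> y" "x \<noteq> z"
    using e1 e2 by (metis prod.collapse)
  \<comment> \<open>Reversing both arcs puts the end \<open>x\<close> of \<open>e\<close> on the same footing as the end \<open>y\<close>.\<close>
  have "(x, w) \<in> parcs (cube k)" "(y, x) \<in> parcs (cube k)"
    using arc[OF e1(1)] arc[OF e(1)] arcs_ends_symmetric[OF sym_arcs] unfolding eqs by auto
  then have "2 * len e1 \<le> len e"
    using shorter_adjacent_arc[of y x k w] longest[OF e1(1)] eqs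
    by (simp add: len_def abs_minus_commute)
  moreover have "2 * len e2 \<le> len e"
    using shorter_adjacent_arc[of x y k z] longest[OF e2(1)] arc[OF e2(1)] arc[OF e(1)] eqs
    by (simp add: len_def)
  ultimately show False
    using arc[OF e(1)] arc[OF e1(1)] arc[OF e2(1)] unfolding eqs straddles_def len_def by auto
qed

section \<open>The tournament\<close>

definition odd_digit_sum :: "nat \<Rightarrow> nat \<Rightarrow> bool" where
  "odd_digit_sum k x \<longleftrightarrow> odd (card {i. i < k \<and> bit x i})"

lemma odd_digit_sum_flip_bit:
  assumes "i < k"
  shows "odd_digit_sum k (flip_bit i x) \<longleftrightarrow> \<not> odd_digit_sum k x"
proof -
  let ?B = "\<lambda>x. {i. i < k \<and> bit x i}"
  have "?B (flip_bit i x) = (if bit x i then ?B x - {i} else insert i (?B x))"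
    using assms by (auto simp: bit_simps)
  then show ?thesis
    using assms by (auto simp: odd_digit_sum_def card_Diff_singleton card_gt_0_iff)
qed

definition parity_tournament :: "nat \<Rightarrow> nat pair_pre_digraph" where
  "parity_tournament k = \<lparr>pverts = {..<2 ^ k},
     parcs = {(x, y). x < 2 ^ k \<and> y < 2 ^ k \<and> x \<noteq> y \<and>
       (x < y \<longleftrightarrow> (odd_digit_sum k x \<longleftrightarrow> odd_digit_sum k y))}\<rparr>"

lemma tournament_parity_tournament: "tournament (parity_tournament k)"
proof -
  have "finite (parcs (parity_tournament k))"
    by (rule finite_subset[of _ "{..<2 ^ k} \<times> {..<2 ^ k}"]) (auto simp: parity_tournament_def)
  then have "pair_digraph (parity_tournament k)"
    by unfold_locales (auto simp: parity_tournament_def)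
  then interpret pair_digraph "parity_tournament k" .
  have "digraph (parity_tournament k)" by unfold_locales
  then show ?thesis by (auto simp: tournament_def) (auto simp: parity_tournament_def)
qed

lemma common_out_neighbours_straddle:
  assumes "(x, y) \<in> parcs (cube k)"
    and "x \<in> out_neighbourhood (parity_tournament k) v"
    and "y \<in> out_neighbourhood (parity_tournament k) v"
  shows "straddles v (x, y)"
proof -
  have "odd_digit_sum k x \<longleftrightarrow> \<not> odd_digit_sum k y"
    using assms(1) by (auto simp: cube_def odd_digit_sum_flip_bit)
  then show ?thesis
    using assms(2,3)
    by (auto simp: out_neighbourhood_def parity_tournament_def straddles_def)
qed

theorem proposition5:
  fixes k :: nat
  assumes "k \<ge> 1"
  shows "\<exists>(G :: nat pair_pre_digraph) (T :: nat pair_pre_digraph).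
           verts G \<noteq> {} \<and> regular_graph k G \<and> tournament T \<and> verts T = verts G \<and>
           (\<forall>v\<in>verts G. undirected_forest (G \<restriction> out_neighbourhood T v))"
proof (intro exI conjI ballI)
  show "verts (cube k) \<noteq> {}" by (auto simp: cube_def lessThan_empty_iff)
  show "regular_graph k (cube k)" by (rule regular_cube)
  show "tournament (parity_tournament k)" by (rule tournament_parity_tournament)
  show "verts (parity_tournament k) = verts (cube k)"
    by (simp add: cube_def parity_tournament_def)
next
  fix v
  show "undirected_forest (cube k \<restriction> out_neighbourhood (parity_tournament k) v)"
  proof (rule straddling_edges_acyclic)
    show "out_neighbourhood (parity_tournament k) v \<subseteq> verts (cube k)"
      by (auto simp: out_neighbourhood_def parity_tournament_def cube_def)
  qed (rule common_out_neighbours_straddle)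
qed

end
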